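(* For $2\le a\le b$ let $K_{a,b}$ denote the useful orientation of the complete bipartite graph with parts of sizes $a$ and $b$, and let $c=(b-a)(a-1)+a(a-2)+1$. Then $T_c(K_{a,b})=\Omega(a!)$; that is, there exist a constant $\kappa>0$ and an integer $N$ such that for all $a\ge N$ and all $b\ge a$, with $c=(b-a)(a-1)+a(a-2)+1$, one has $T_c(K_{a,b})\ge\kappa\, a!$.
   Context: A directed graph $D=(V,E)$ is a finite set of vertices $V$ with a set $E$ of ordered pairs of vertices; $(u,v)\in E$ is an edge directed from $u$ to $v$, and the out-degree $\deg^+ v$ is the number of edges directed from $v$. A parallel chip-firing game on $D$ starts with a finite nonnegative integer number of chips on each vertex. In each round, simultaneously, every vertex $v$ having at least $\deg^+ v$ chips fires, sending one chip along each of its outgoing edges; all other vertices wait. The game has period $T$ if $T$ is the smallest positive integer for which there is a round $t_0$ such that every vertex has the same number of chips in round $t$ as in round $t+T$ for all $t\ge t_0$. For a nonnegative integer $c$, the $c$-convergent period $T_c(D)$ is the minimum of the period $T$ over all parallel chip-firing games on $D$ with at least $c$ chips in total. The useful orientation of the complete bipartite graph $K_{a,a}$ with vertices $v_1,\dots,v_{2a}$, where the odd-indexed vertices form one part $L$ and the even-indexed vertices form the other part $R$, has exactly the following edges: (i) from $v_i$ to $v_{i+1}$ for each $1\le i<2a$, and from $v_{2a}$ to $v_1$; (ii) from $v_1$ to $v_{2i}$ for all $1\le i<a$; (iii) from $v_{2j+1}$ to all vertices $v_{2k}$ with $1\le k<j$ (for every $j$ with $1\le j\le a-1$); (iv) from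 $v_{2j}$ to all vertices $v_{2k-1}$ with $1<k<j$ (for every $j$ with $1\le j\le a$). A sink component of a directed graph is a strongly connected component with no edge leaving it (a sink in the condensation). For $a\le b$, let the complete bipartite graph $K_{a,b}$ have parts $L,R$ with $|L|=a$, $|R|=b$ and vertices $v_1,\dots,v_{a+b}$, where $L$ consists of the $v_i$ with $i\le 2a$ odd, and $R$ consists of the $v_i$ with $i\le 2a$ even together with all $v_i$, $2a<i\le a+b$. An orientation of $K_{a,b}$ is useful if the subgraph induced by $v_1,\dots,v_{2a}$ is the useful orientation of $K_{a,a}$ and this induced subgraph is the only sink component. *)

theory Defs
  imports Complex_Main "Graph_Theory.Graph_Theory"
begin

text \<open>
  A chip configuration is a function \<^typ>\<open>'a \<Rightarrow> nat\<close>; only its values on the vertices of the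
  digraph are meaningful.
\<close>

definition fires :: "'a pair_pre_digraph \<Rightarrow> ('a \<Rightarrow> nat) \<Rightarrow> 'a \<Rightarrow> bool" where
  "fires D \<sigma> v \<longleftrightarrow> v \<in> pverts D \<and> out_degree D v \<le> \<sigma> v"

definition fire_round :: "'a pair_pre_digraph \<Rightarrow> ('a \<Rightarrow> nat) \<Rightarrow> ('a \<Rightarrow> nat)" where
  "fire_round D \<sigma> v =
     (if fires D \<sigma> v then \<sigma> v - out_degree D v else \<sigma> v)
     + card {u. (u, v) \<in> parcs D \<and> fires D \<sigma> u}"

definition chips_at :: "'a pair_pre_digraph \<Rightarrow> ('a \<Rightarrow> nat) \<Rightarrow> nat \<Rightarrow> ('a \<Rightarrow> nat)" where
  "chips_at D \<sigma> t = (fire_round D ^^ t) \<sigma>"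

definition eventually_repeats :: "'a pair_pre_digraph \<Rightarrow> ('a \<Rightarrow> nat) \<Rightarrow> nat \<Rightarrow> bool" where
  "eventually_repeats D \<sigma> T \<longleftrightarrow>
     (\<exists>t0. \<forall>t\<ge>t0. \<forall>v\<in>pverts D. chips_at D \<sigma> (t + T) v = chips_at D \<sigma> t v)"

definition has_period :: "'a pair_pre_digraph \<Rightarrow> ('a \<Rightarrow> nat) \<Rightarrow> nat \<Rightarrow> bool" where
  "has_period D \<sigma> T \<longleftrightarrow> 0 < T \<and> eventually_repeats D \<sigma> T
     \<and> (\<forall>T'. 0 < T' \<and> eventually_repeats D \<sigma> T' \<longrightarrow> T \<le> T')"

text \<open>
  On a finite nonempty digraph every game has a period, since the number of chips is preserved,
  and there are games with at least \<open>c\<close> chips; so the minimum below is attained.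
\<close>

definition convergent_period :: "nat \<Rightarrow> 'a pair_pre_digraph \<Rightarrow> nat" where
  "convergent_period c D =
     (LEAST T. \<exists>\<sigma>. c \<le> (\<Sum>v\<in>pverts D. \<sigma> v) \<and> has_period D \<sigma> T)"

definition bipartite_orientation :: "'a set \<Rightarrow> 'a set \<Rightarrow> 'a pair_pre_digraph \<Rightarrow> bool" where
  "bipartite_orientation L R D \<longleftrightarrow>
     pverts D = L \<union> R \<and> parcs D \<subseteq> L \<times> R \<union> R \<times> L
     \<and> (\<forall>u\<in>L. \<forall>w\<in>R. (u, w) \<in> parcs D \<longleftrightarrow> (w, u) \<notin> parcs D)"

definition sink_components :: "('a, 'b) pre_digraph \<Rightarrow> ('a, 'b) pre_digraph set" where
  "sink_components G =
     {H \<in> pre_digraph.sccs G. \<forall>e\<in>arcs G. tail G e \<in> verts H \<longrightarrow> head G e \<in> verts H}"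

text \<open>The vertex \<open>v\<^sub>i\<close> is represented by the natural number \<open>i\<close>.\<close>

definition useful_Kaa :: "nat \<Rightarrow> nat pair_pre_digraph" where
  "useful_Kaa a = \<lparr> pverts = {1..2 * a},
     parcs = {(i, i + 1) | i. 1 \<le> i \<and> i < 2 * a} \<union> {(2 * a, 1)}
       \<union> {(1, 2 * i) | i. 1 \<le> i \<and> i < a}
       \<union> {(2 * j + 1, 2 * k) | j k. 1 \<le> j \<and> j \<le> a - 1 \<and> 1 \<le> k \<and> k < j}
       \<union> {(2 * j, 2 * k - 1) | j k. 1 \<le> j \<and> j \<le> a \<and> 1 < k \<and> k < j} \<rparr>"

definition Kab_left :: "nat \<Rightarrow> nat set" where
  "Kab_left a = {i \<in> {1..2 * a}. odd i}"

definition Kab_right :: "nat \<Rightarrow> nat \<Rightarrow> nat set" where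
  "Kab_right a b = {i \<in> {1..2 * a}. even i} \<union> {2 * a<..a + b}"

definition useful_Kab :: "nat \<Rightarrow> nat \<Rightarrow> nat pair_pre_digraph \<Rightarrow> bool" where
  "useful_Kab a b D \<longleftrightarrow>
     bipartite_orientation (Kab_left a) (Kab_right a b) D
     \<and> with_proj D \<restriction> {1..2 * a} = with_proj (useful_Kaa a)
     \<and> sink_components D = {with_proj D \<restriction> {1..2 * a}}"

end

theory Submission
  imports Defs
begin

text \<open>
  A configuration in which no vertex fires holds at most \<open>|E| - |V|\<close> chips, and \<open>c\<close> is exactly
  \<open>|E| - |V| + 1\<close>, so some vertex fires in every round. Hence the numbers \<open>f v \<le> T\<close> of firings
  within one period form a nonzero vector with \<open>deg\<^sup>+ v \<cdot> f v = (\<Sum>u \<rightarrow> v. f u)\<close>. It vanishes on the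
  vertices \<open>v\<^sub>i\<close> with \<open>i > 2a\<close>, which receive no chips. On the sink component the balance equations
  can be solved from the top index downwards, starting at \<open>v\<^sub>1\<close>, and every second step multiplies
  the value by a factor that grows linearly in the index; this gives \<open>2 f v\<^sub>5 \<ge> a! \<cdot> f v\<^sub>1\<close>.
\<close>

section \<open>Arithmetic of the balance equations on the sink component\<close>

text \<open>Here \<open>n = a - 1\<close>, and \<open>x j\<close>, \<open>y k\<close> stand for the firing numbers of \<open>v\<^bsub>2j+1\<^esub>\<close>, \<open>v\<^bsub>2k\<^esub>\<close>.\<close>

lemma balance_growth:
  fixes x y :: "nat \<Rightarrow> nat"
  assumes n: "2 \<le> n"
    and y_last: "n * x 0 = y (Suc n)"
    and x_last: "n * y (Suc n) = x n"
    and x_eq: "\<And>k. 1 \<le> k \<Longrightarrow> k \<le> n \<Longrightarrow> k * x k = y k + (\<Sum>j=k+2..Suc n. y j)"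
    and y_eq: "\<And>k. 2 \<le> k \<Longrightarrow> k \<le> n \<Longrightarrow> (k - 1) * y k = x 0 + x (k - 1) + (\<Sum>j=k+1..n. x j)"
  shows "fact (Suc n) * x 0 \<le> 2 * x 2"
proof -
  \<comment> \<open>The tail sums stay dominated by the latest term, so subtracting them costs little.\<close>
  define P where "P k \<longleftrightarrow> x 0 + (\<Sum>j=k+1..n. x j) \<le> x k \<and> (\<Sum>j=k+2..Suc n. y j) \<le> y (k + 1)
    \<and> y (k + 1) \<le> x k \<and> x n * fact (n - 1) \<le> x k * fact (k - 1)" for k
  have "P 2" using n
  proof (induction rule: inc_induct)
    case base
    have "x n = n * n * x 0" using x_last y_last by (metis mult.assoc)
    moreover have "x 0 \<le> n * n * x 0" "y (Suc n) \<le> n * y (Suc n)" using n by auto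
    ultimately show ?case using x_last by (simp add: P_def)
  next
    case (step k)
    let ?X = "x (Suc k)" and ?Y = "y (Suc k)"
    have IH: "x 0 + (\<Sum>j=k+2..n. x j) \<le> ?X" "(\<Sum>j=k+3..Suc n. y j) \<le> y (k + 2)"
      "y (k + 2) \<le> ?X" "x n * fact (n - 1) \<le> ?X * fact k"
      using step.IH by (simp_all add: P_def numeral_3_eq_3)
    have kX: "k * ?X + ?X = ?Y + (\<Sum>j=k+3..Suc n. y j)"
      using x_eq[of "Suc k"] step.hyps by (simp add: numeral_3_eq_3 del: sum.cl_ivl_Suc)
    have kY: "k * ?Y = x 0 + x k + (\<Sum>j=k+2..n. x j)"
      using y_eq[of "Suc k"] step.hyps by simp
    \<comment> \<open>The tail of the \<open>y\<close>-sum is at most \<open>y (k + 2)\<close>,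
      hence at most \<open>?X\<close>; the coefficient thus drops only from \<open>k + 1\<close> to
      \<open>k\<close>. This is the growth factor collected in the factorial.\<close>
    have Y: "k * ?X \<le> ?Y" using kX IH by linarith
    have k2: "2 * ?X \<le> k * ?X" using step.hyps by simp
    \<comment> \<open>The factor \<open>k\<close> only absorbs the terms other than
      \<open>x k\<close>, which total at most \<open>?X\<close> and so at most \<open>?Y\<close>.
      This takes \<open>2 \<le> k\<close>, which is why the descent ends at
      \<open>x 2\<close>.\<close>
    have "2 * ?Y \<le> k * ?Y" using step.hyps by simp
    then have xk: "?Y \<le> x k" using kY IH Y k2 by linarith
    have "(\<Sum>j=k+1..n. x j) = ?X + (\<Sum>j=k+2..n. x j)"
      using step.hyps by (simp add: sum.atLeast_Suc_atMost)
    then have "x 0 + (\<Sum>j=k+1..n. x j) \<le> x k" using IH xk Y k2 by linarith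
    moreover have "(\<Sum>j=k+2..Suc n. y j) = y (k + 2) + (\<Sum>j=k+3..Suc n. y j)"
      using step.hyps by (simp add: sum.atLeast_Suc_atMost numeral_3_eq_3 del: sum.cl_ivl_Suc)
    then have "(\<Sum>j=k+2..Suc n. y j) \<le> ?Y" using IH Y k2 by linarith
    moreover have "?X * fact k \<le> x k * fact (k - 1)"
    proof -
      have "?X * fact k = k * ?X * fact (k - 1)"
        using step.hyps by (simp add: fact_reduce)
      then show ?thesis using Y xk by (metis le_trans mult_le_mono1)
    qed
    moreover have "x n * fact (n - 1) \<le> ?X * fact k" by (fact IH)
    ultimately show ?case using xk unfolding P_def Suc_eq_plus1 by (meson le_trans)
  qed
  then have "n * n * x 0 * fact (n - 1) \<le> x 2"
    using x_last y_last by (simp add: P_def) (metis mult.assoc)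
  moreover have "fact (Suc n) * x 0 \<le> 2 * (n * n * x 0 * fact (n - 1))"
  proof -
    have "fact (Suc n) = Suc n * n * (fact (n - 1) :: nat)"
      using n by (simp add: fact_reduce[of n] algebra_simps)
    \<comment> \<open>The descent yields \<open>n * n!\<close> rather than \<open>(n + 1)!\<close>;
      trading \<open>n + 1\<close> for \<open>2 * n\<close> is the source of the constant 2.\<close>
    moreover have "Suc n * n \<le> 2 * (n * n)" using n by simp
    ultimately have "fact (Suc n) * x 0 \<le> 2 * (n * n) * fact (n - 1) * x 0"
      by (metis mult_le_mono1)
    then show ?thesis by (simp add: mult_ac)
  qed
  ultimately show ?thesis by linarith
qed

text \<open>Excludes a nonzero firing vector with \<open>x 0 = 0\<close>, for which the growth bound
  is void. Going down from \<open>n\<close>, the left-hand side of each equation vanishes, and in a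
  zero sum of naturals every summand is zero.\<close>

lemma balance_zero:
  fixes x y :: "nat \<Rightarrow> nat"
  assumes x_last: "n * y (Suc n) = x n" and x0: "x 0 = 0" and y_last: "y (Suc n) = 0"
    and x_eq: "\<And>k. 1 \<le> k \<Longrightarrow> k \<le> n \<Longrightarrow> k * x k = y k + (\<Sum>j=k+2..Suc n. y j)"
    and y_eq: "\<And>k. 2 \<le> k \<Longrightarrow> k \<le> n \<Longrightarrow> (k - 1) * y k = x 0 + x (k - 1) + (\<Sum>j=k+1..n. x j)"
    and k: "1 \<le> k" "k \<le> n"
  shows "x k = 0 \<and> y k = 0"
  using k(2,1)
proof (induction k rule: inc_induct)
  case base
  then show ?case using x_last y_last x_eq[of n] by simp
next
  case (step k)
  then have "x k = 0" using y_eq[of "Suc k"] by simp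
  then show ?case using x_eq[of k] step by simp
qed

section \<open>Balance, conservation and periodicity on finite digraphs\<close>

context pair_fin_digraph
begin

lemma out_degree_eq_card: "out_degree (with_proj G) v = card {w. (v, w) \<in> parcs G}"
proof -
  have "out_arcs (with_proj G) v = Pair v ` {w. (v, w) \<in> parcs G}"
    by (auto simp: out_arcs_def)
  then show ?thesis by (simp add: out_degree_def card_image inj_on_def)
qed

lemma finite_in_nbrs: "finite {u. (u, v) \<in> parcs G}"
  by (rule finite_subset[OF _ pair_finite_verts]) (auto dest: in_arcsD1)

text \<open>A firing vertex holds at least its out-degree, so the truncated subtraction is exact and
  can be moved to the left. The indicators \<open>of_bool\<close> make the equation additive over
  rounds.\<close>

lemma fire_round_balance:
  "fire_round G \<sigma> v + out_degree G v * of_bool (fires G \<sigma> v)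
     = \<sigma> v + (\<Sum>u | (u, v) \<in> parcs G. of_bool (fires G \<sigma> u))"
  using finite_in_nbrs[of v]
  by (auto simp: fire_round_def fires_def sum_of_bool_eq Collect_conj_eq)

text \<open>Telescoping of the one-round balance; the sums over \<open>s\<close> count firings in a
  window of \<open>T\<close> rounds.\<close>

lemma chips_at_balance:
  "chips_at G \<sigma> (t + T) v + out_degree G v * (\<Sum>s<T. of_bool (fires G (chips_at G \<sigma> (t + s)) v))
     = chips_at G \<sigma> t v
       + (\<Sum>u | (u, v) \<in> parcs G. \<Sum>s<T. of_bool (fires G (chips_at G \<sigma> (t + s)) u))"
proof (induction T)
  case (Suc T)
  have "chips_at G \<sigma> (t + Suc T) = fire_round G (chips_at G \<sigma> (t + T))"
    by (simp add: chips_at_def)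
  then show ?case
    using Suc.IH fire_round_balance[of "chips_at G \<sigma> (t + T)" v]
    by (simp add: sum.distrib algebra_simps)
qed simp

text \<open>Double counting of the arcs with a firing tail: summed by head they are the chips
  received, summed by tail the chips sent.\<close>

lemma sum_fire_round: "(\<Sum>v\<in>pverts G. fire_round G \<sigma> v) = (\<Sum>v\<in>pverts G. \<sigma> v)"
proof -
  let ?f = "\<lambda>u. of_bool (fires G \<sigma> u) :: nat"
  have "(\<Sum>v\<in>pverts G. \<Sum>u | (u, v) \<in> parcs G. ?f u)
      = (\<Sum>v\<in>pverts G. \<Sum>u\<in>pverts G. of_bool ((u, v) \<in> parcs G) * ?f u)"
    by (intro sum.cong[OF refl] sum.mono_neutral_cong_left)
       (auto simp: pair_finite_verts dest: in_arcsD1)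
  also have "\<dots> = (\<Sum>u\<in>pverts G. \<Sum>v\<in>pverts G. of_bool ((u, v) \<in> parcs G) * ?f u)"
    by (rule sum.swap)
  also have "\<dots> = (\<Sum>u\<in>pverts G. out_degree G u * ?f u)"
  proof (rule sum.cong)
    fix u
    have "pverts G \<inter> {v. (u, v) \<in> parcs G} = {v. (u, v) \<in> parcs G}"
      by (auto dest: in_arcsD2)
    then show "(\<Sum>v\<in>pverts G. of_bool ((u, v) \<in> parcs G) * ?f u) = out_degree G u * ?f u"
      by (simp add: pair_finite_verts sum_of_bool_eq out_degree_eq_card flip: sum_distrib_right)
  qed simp
  finally have swap: "(\<Sum>v\<in>pverts G. \<Sum>u | (u, v) \<in> parcs G. ?f u)
      = (\<Sum>u\<in>pverts G. out_degree G u * ?f u)" .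
  have "(\<Sum>v\<in>pverts G. fire_round G \<sigma> v + out_degree G v * ?f v)
      = (\<Sum>v\<in>pverts G. \<sigma> v + (\<Sum>u | (u, v) \<in> parcs G. ?f u))"
    by (intro sum.cong refl fire_round_balance)
  then show ?thesis by (simp only: sum.distrib swap add_right_cancel)
qed

lemma sum_chips_at: "(\<Sum>v\<in>pverts G. chips_at G \<sigma> t v) = (\<Sum>v\<in>pverts G. \<sigma> v)"
  by (induction t) (simp_all add: chips_at_def sum_fire_round)

lemma fire_round_cong:
  assumes "\<And>v. v \<in> pverts G \<Longrightarrow> \<sigma> v = \<tau> v" and "v \<in> pverts G"
  shows "fire_round G \<sigma> v = fire_round G \<tau> v"
proof -
  have "fires G \<sigma> u = fires G \<tau> u" for u using assms(1) by (auto simp: fires_def)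
  then show ?thesis using assms by (simp add: fire_round_def)
qed

text \<open>Conservation bounds every vertex, so by pigeonhole two rounds agree on the vertices;
  determinism propagates the agreement to all later rounds.\<close>

lemma ex_has_period: "\<exists>T. has_period G \<sigma> T"
proof -
  \<comment> \<open>Values off the vertex set are irrelevant; \<open>restrict\<close> normalises
    them, which places all configurations in one finite \<open>PiE\<close> set.\<close>
  let ?c = "\<lambda>t. restrict (chips_at G \<sigma> t) (pverts G)"
  have "chips_at G \<sigma> t v \<le> (\<Sum>v\<in>pverts G. \<sigma> v)" if "v \<in> pverts G" for t v
    using member_le_sum[OF that, of "chips_at G \<sigma> t"] by (simp add: pair_finite_verts sum_chips_at)
  then have "range ?c \<subseteq> pverts G \<rightarrow>\<^sub>E {..\<Sum>v\<in>pverts G. \<sigma> v}" by auto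
  then have "finite (range ?c)" by (rule finite_subset) (intro finite_PiE, auto simp: pair_finite_verts)
  then have "\<not> inj ?c" using finite_imageD infinite_UNIV_nat by blast
  then obtain s t where "s < t" and eq: "?c s = ?c t"
    unfolding inj_def by (metis linorder_neqE_nat)
  have "\<forall>v\<in>pverts G. chips_at G \<sigma> (s + d) v = chips_at G \<sigma> (t + d) v" for d
  proof (induction d)
    case 0
    then show ?case using eq by (metis add_0_right restrict_apply')
  next
    case (Suc d)
    then show ?case by (auto simp: chips_at_def intro: fire_round_cong)
  qed
  note rep = this
  have "chips_at G \<sigma> (r + (t - s)) v = chips_at G \<sigma> r v" if "s \<le> r" "v \<in> pverts G" for r v
  proof -
    have "r + (t - s) = t + (r - s)" "r = s + (r - s)" using that \<open>s < t\<close> by auto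
    then show ?thesis using rep[of "r - s"] that by metis
  qed
  then have ex: "0 < t - s \<and> eventually_repeats G \<sigma> (t - s)"
    using \<open>s < t\<close> unfolding eventually_repeats_def by auto
  show ?thesis unfolding has_period_def
    by (rule exI[of _ "LEAST T. 0 < T \<and> eventually_repeats G \<sigma> T"])
       (use LeastI[of "\<lambda>T. 0 < T \<and> eventually_repeats G \<sigma> T", OF ex] in \<open>auto intro: Least_le\<close>)
qed

lemma convergent_period_attained:
  assumes "pverts G \<noteq> {}"
  obtains \<sigma> where "c \<le> (\<Sum>v\<in>pverts G. \<sigma> v)" "has_period G \<sigma> (convergent_period c G)"
proof -
  \<comment> \<open>The game with \<open>c\<close> chips on every vertex shows that the minimum is
    over a nonempty set.\<close>
  have "c \<le> (\<Sum>v\<in>pverts G. c)" using assms by (simp add: pair_finite_verts card_gt_0_iff Suc_leI)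
  then have "\<exists>T \<sigma>. c \<le> (\<Sum>v\<in>pverts G. \<sigma> v) \<and> has_period G \<sigma> T"
    using ex_has_period by blast
  from LeastI_ex[OF this] show ?thesis
    using that unfolding convergent_period_def by blast
qed

lemma firing_vector:
  assumes "has_period G \<sigma> T"
    and "(\<Sum>v\<in>pverts G. out_degree G v - 1) < (\<Sum>v\<in>pverts G. \<sigma> v)"
  obtains f where "\<And>v. f v \<le> T" "\<exists>v\<in>pverts G. 0 < f v"
    "\<And>v. v \<in> pverts G \<Longrightarrow> out_degree G v * f v = (\<Sum>u | (u, v) \<in> parcs G. f u)"
proof -
  from assms(1) obtain t where T: "0 < T"
    and t: "\<And>v. v \<in> pverts G \<Longrightarrow> chips_at G \<sigma> (t + T) v = chips_at G \<sigma> t v"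
    unfolding has_period_def eventually_repeats_def by blast
  define f :: "'a \<Rightarrow> nat" where "f v = (\<Sum>s<T. of_bool (fires G (chips_at G \<sigma> (t + s)) v))" for v
  show ?thesis
  proof
    show "f v \<le> T" for v
      using sum_bounded_above[of "{..<T}" "\<lambda>s. of_bool (fires G (chips_at G \<sigma> (t + s)) v)" "1 :: nat"]
      by (simp add: f_def)
    show "\<exists>v\<in>pverts G. 0 < f v"
    proof -
      have "\<exists>v\<in>pverts G. fires G (chips_at G \<sigma> t) v"
      proof (rule ccontr)
        assume "\<not> ?thesis"
        \<comment> \<open>A waiting vertex has positive out-degree, since out-degree 0 always fires;
          the truncated \<open>- 1\<close> is therefore exact here.\<close>
        then have "chips_at G \<sigma> t v \<le> out_degree G v - 1" if "v \<in> pverts G" for v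
          using that by (fastforce simp: fires_def)
        then have "(\<Sum>v\<in>pverts G. chips_at G \<sigma> t v) \<le> (\<Sum>v\<in>pverts G. out_degree G v - 1)"
          by (rule sum_mono)
        then show False using assms(2) by (simp add: sum_chips_at)
      qed
      then obtain v where v: "v \<in> pverts G" "fires G (chips_at G \<sigma> t) v" by blast
      have "of_bool (fires G (chips_at G \<sigma> (t + 0)) v) \<le> f v"
        unfolding f_def using T by (intro member_le_sum) auto
      then have "0 < f v" using v by simp
      then show ?thesis using v by blast
    qed
    show "out_degree G v * f v = (\<Sum>u | (u, v) \<in> parcs G. f u)" if "v \<in> pverts G" for v
      using chips_at_balance[of \<sigma> t T v] t[OF that] by (simp add: f_def)
  qed
qed

end

section \<open>Arcs of a useful orientation\<close>

text \<open>The sink condition determines the orientation outside the core: no arc leaves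
  \<open>{1..2 * a}\<close>, so each edge between \<open>L\<close> and a vertex \<open>v_i\<close>
  with \<open>i > 2a\<close> must point into \<open>L\<close>.\<close>

lemma useful_Kab_arcs:
  assumes D: "useful_Kab a b D" and "a \<le> b"
  shows "pverts D = {1..a + b}"
    and "parcs D = parcs (useful_Kaa a) \<union> {2 * a<..a + b} \<times> Kab_left a"
proof -
  have bip: "bipartite_orientation (Kab_left a) (Kab_right a b) D"
    and ind: "with_proj D \<restriction> {1..2 * a} = with_proj (useful_Kaa a)"
    and sink: "sink_components D = {with_proj D \<restriction> {1..2 * a}}"
    using D by (auto simp: useful_Kab_def)
  show "pverts D = {1..a + b}"
  proof -
    have "Kab_left a \<union> Kab_right a b = {1..2 * a} \<union> {2 * a<..a + b}"
      unfolding Kab_left_def Kab_right_def by blast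
    also have "\<dots> = {1..a + b}" using \<open>a \<le> b\<close> by auto
    finally show ?thesis using bip by (simp add: bipartite_orientation_def)
  qed
  have inner: "{e \<in> parcs D. fst e \<in> {1..2 * a} \<and> snd e \<in> {1..2 * a}} = parcs (useful_Kaa a)"
    using arg_cong[OF ind, of arcs] by (simp add: induce_subgraph_def)
  have "with_proj D \<restriction> {1..2 * a} \<in> sink_components D" using sink by simp
  then have out: "w \<in> {1..2 * a}" if "(u, w) \<in> parcs D" "u \<in> {1..2 * a}" for u w
    using that unfolding sink_components_def by (auto dest!: bspec)
  have sub: "parcs D \<subseteq> Kab_left a \<times> Kab_right a b \<union> Kab_right a b \<times> Kab_left a"
    and ori: "\<And>u w. u \<in> Kab_left a \<Longrightarrow> w \<in> Kab_right a b \<Longrightarrow> (u, w) \<in> parcs D \<longleftrightarrow> (w, u) \<notin> parcs D"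
    using bip unfolding bipartite_orientation_def by simp_all
  have "{2 * a<..a + b} \<times> Kab_left a \<subseteq> parcs D"
  proof clarify
    fix w u assume w: "w \<in> {2 * a<..a + b}" and u: "u \<in> Kab_left a"
    then have "(u, w) \<notin> parcs D" using out[of u w] by (auto simp: Kab_left_def)
    moreover have "w \<in> Kab_right a b" using w by (simp add: Kab_right_def)
    ultimately show "(w, u) \<in> parcs D" using ori[OF u] by blast
  qed
  moreover have "parcs (useful_Kaa a) \<subseteq> parcs D" using inner by blast
  moreover have "(u, w) \<in> parcs (useful_Kaa a) \<union> {2 * a<..a + b} \<times> Kab_left a"
    if e: "(u, w) \<in> parcs D" for u w
  proof (cases "u \<in> {1..2 * a}")
    case True
    then have "(u, w) \<in> {e \<in> parcs D. fst e \<in> {1..2 * a} \<and> snd e \<in> {1..2 * a}}"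
      using out[OF e] e by simp
    then show ?thesis unfolding inner by blast
  next
    case False
    then have "u \<notin> Kab_left a" by (auto simp: Kab_left_def)
    then have "u \<in> Kab_right a b" "w \<in> Kab_left a" using subsetD[OF sub e] by blast+
    moreover from this have "u \<in> {2 * a<..a + b}" using False unfolding Kab_right_def by blast
    ultimately show ?thesis by blast
  qed
  ultimately show "parcs D = parcs (useful_Kaa a) \<union> {2 * a<..a + b} \<times> Kab_left a"
    by (intro equalityI[OF subrelI Un_least])
qed

text \<open>The defining arc sets in half-indices: \<open>k < j\<close> is kind (iii),
  \<open>k = Suc j\<close> the cycle arc of kind (i), and \<open>j = 0\<close> kind (ii).\<close>

lemma useful_Kaa_arc_odd:
  assumes "j \<le> n"
  shows "(2 * j + 1, w) \<in> parcs (useful_Kaa (Suc n)) \<longleftrightarrow>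
    (\<exists>k. w = 2 * k \<and> 1 \<le> k \<and> (k < j \<or> k = Suc j \<or> j = 0 \<and> k \<le> n))"
    (is "?L \<longleftrightarrow> ?R")
proof
  show "?L \<Longrightarrow> ?R" 
    by (auto simp: useful_Kaa_def double_not_eq_Suc_double Suc_double_not_eq_double
        intro: exI[of _ "Suc j"])
  show "?R \<Longrightarrow> ?L" using assms by (auto simp: useful_Kaa_def)
qed

text \<open>The first disjunct is kind (iv), shifted by one because its heads are indexed as
  \<open>2 * k - 1\<close>; the others are the cycle arcs, the last one closing the cycle at
  \<open>v_1\<close>.\<close>

lemma useful_Kaa_arc_even:
  assumes "1 \<le> k" "k \<le> Suc n"
  shows "(2 * k, w) \<in> parcs (useful_Kaa (Suc n)) \<longleftrightarrow>
    (\<exists>j. w = 2 * j + 1 \<and> (1 \<le> j \<and> Suc j < k \<or> j = k \<and> k \<le> n \<or> j = 0 \<and> k = Suc n))"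
    (is "?L \<longleftrightarrow> ?R")
proof
  show "?L \<Longrightarrow> ?R" 
    apply (auto simp: useful_Kaa_def double_not_eq_Suc_double Suc_double_not_eq_double)
    subgoal for j by (rule exI[of _ "j - 1"]) auto
    done
  show "?R \<Longrightarrow> ?L" using assms by (auto simp: useful_Kaa_def)
qed

lemma useful_Kaa_arcs_range:
  "(u, w) \<in> parcs (useful_Kaa (Suc n)) \<Longrightarrow> u \<in> {1..2 * Suc n} \<and> w \<in> {1..2 * Suc n}"
  by (auto simp: useful_Kaa_def)

lemma vertex_cases:
  assumes "u \<in> {1..2 * Suc n}"
  obtains (odd) j where "j \<le> n" "u = 2 * j + 1" | (even) k where "1 \<le> k" "k \<le> Suc n" "u = 2 * k"
proof (cases "even u")
  case True
  then obtain k where "u = 2 * k" by blast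
  then show ?thesis using that(2)[of k] assms by auto
next
  case False
  then obtain j where "u = 2 * j + 1" by (blast elim: oddE)
  then show ?thesis using that(1)[of j] assms by auto
qed

lemma sum_pairs: "(\<Sum>v=1..2 * m. g v) = (\<Sum>j<m. g (2 * j + 1) + g (2 * j + 2))"
  for g :: "nat \<Rightarrow> nat"
  by (induction m) (simp_all add: add.assoc)

section \<open>Degrees and in-neighbourhoods for \<open>a = n + 1\<close>\<close>

context
  fixes n b :: nat and D :: "nat pair_pre_digraph"
  assumes n: "2 \<le> n" and b: "Suc n \<le> b" and D: "useful_Kab (Suc n) b D"
begin

lemma arcs_D:
  "(u, w) \<in> parcs D \<longleftrightarrow> (u, w) \<in> parcs (useful_Kaa (Suc n))
     \<or> u \<in> {2 * Suc n<..Suc n + b} \<and> w \<le> 2 * Suc n \<and> odd w"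
proof -
  have "w \<in> Kab_left (Suc n) \<longleftrightarrow> w \<le> 2 * Suc n \<and> odd w"
    by (cases w) (auto simp: Kab_left_def)
  then show ?thesis
    by (simp only: useful_Kab_arcs(2)[OF D b] Un_iff mem_Times_iff fst_conv snd_conv)
qed

lemma pverts_D: "pverts D = {1..2 * Suc n} \<union> {2 * Suc n<..Suc n + b}"
proof -
  have "{1..Suc n + b} = {1..2 * Suc n} \<union> {2 * Suc n<..Suc n + b}" using b by auto
  then show ?thesis using useful_Kab_arcs(1)[OF D b] by simp
qed

lemma fin_D: "pair_fin_digraph D"
proof
  have sub: "parcs D \<subseteq> pverts D \<times> pverts D"
  proof (intro subrelI)
    fix u w assume "(u, w) \<in> parcs D"
    then show "(u, w) \<in> pverts D \<times> pverts D"
      unfolding arcs_D pverts_D using useful_Kaa_arcs_range[of u w n] by (cases w) auto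
  qed
  have fin: "finite (pverts D)" by (simp add: pverts_D)
  show "finite (pverts D)" by (fact fin)
  show "finite (parcs D)" using finite_subset[OF sub] fin by blast
  show "fst e \<in> pverts D" "snd e \<in> pverts D" if "e \<in> parcs D" for e
    using sub that by auto
qed

interpretation pair_fin_digraph D by (fact fin_D)

lemma arc_odd:
  assumes "j \<le> n"
  shows "(2 * j + 1, w) \<in> parcs D \<longleftrightarrow>
    (\<exists>k. w = 2 * k \<and> 1 \<le> k \<and> (k < j \<or> k = Suc j \<or> j = 0 \<and> k \<le> n))"
proof -
  have "2 * j + 1 \<notin> {2 * Suc n<..Suc n + b}" using assms by simp
  then show ?thesis by (simp only: arcs_D useful_Kaa_arc_odd[OF assms] simp_thms)
qed

lemma arc_even:
  assumes "1 \<le> k" "k \<le> Suc n"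
  shows "(2 * k, w) \<in> parcs D \<longleftrightarrow>
    (\<exists>j. w = 2 * j + 1 \<and> (1 \<le> j \<and> Suc j < k \<or> j = k \<and> k \<le> n \<or> j = 0 \<and> k = Suc n))"
proof -
  have "2 * k \<notin> {2 * Suc n<..Suc n + b}" using assms by simp
  then show ?thesis by (simp only: arcs_D useful_Kaa_arc_even[OF assms] simp_thms)
qed

lemma arc_extra:
  assumes "u \<in> {2 * Suc n<..Suc n + b}"
  shows "(u, w) \<in> parcs D \<longleftrightarrow> w \<le> 2 * Suc n \<and> odd w"
proof -
  have "(u, w) \<notin> parcs (useful_Kaa (Suc n))" using assms useful_Kaa_arcs_range by fastforce
  then show ?thesis using assms by (simp only: arcs_D simp_thms)
qed

lemma tail_cases:
  assumes "(u, w) \<in> parcs D"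
  obtains (odd) j where "j \<le> n" "u = 2 * j + 1"
  | (even) k where "1 \<le> k" "k \<le> Suc n" "u = 2 * k"
  | (extra) "u \<in> {2 * Suc n<..Suc n + b}"
  using assms in_arcsD1[OF assms] vertex_cases[of u n] unfolding pverts_D by blast

lemma out_degree_odd: "j \<le> n \<Longrightarrow> out_degree D (2 * j + 1) = (if j = 0 then n else j)"
proof -
  assume j: "j \<le> n"
  \<comment> \<open>Halved heads. At \<open>j = 0\<close> the cycle arc to \<open>v_2\<close> is
    also of kind (ii), so the degree is \<open>n\<close> and not \<open>n + 1\<close>.\<close>
  let ?K = "if j = 0 then {1..n} else insert (Suc j) {1..<j}"
  have "{w. (2 * j + 1, w) \<in> parcs D} = (*) 2 ` ?K"
    unfolding arc_odd[OF j] using n by (auto simp: image_iff) (rule exI[of _ "Suc j"], simp)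
  then show ?thesis
    by (simp add: out_degree_eq_card card_image inj_on_def)
qed

lemma out_degree_even:
  assumes "k \<le> n"
  shows "out_degree D (2 * k + 2) = (if k = 0 then 1 else k)"
proof -
  \<comment> \<open>Half-indices of the heads; the cycle successor wraps around to
    \<open>v_1\<close> when \<open>k = n\<close>.\<close>
  let ?J = "insert (if k = n then 0 else Suc k) {1..<k}"
  have k: "1 \<le> Suc k" "Suc k \<le> Suc n" using assms by auto
  have "{w. (2 * Suc k, w) \<in> parcs D} = (\<lambda>j. 2 * j + 1) ` ?J"
    unfolding arc_even[OF k] using assms
    by (auto simp: image_iff) (rule exI[of _ "Suc k"], simp)
  then have "out_degree D (2 * Suc k) = card ((\<lambda>j. 2 * j + 1) ` ?J)"
    by (simp only: out_degree_eq_card)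
  also have "\<dots> = card ?J" by (rule card_image) (simp add: inj_on_def)
  also have "\<dots> = (if k = 0 then 1 else k)" using n by auto
  finally show ?thesis by simp
qed

lemma out_degree_extra:
  assumes "u \<in> {2 * Suc n<..Suc n + b}"
  shows "out_degree D u = Suc n"
proof -
  have "{w. (u, w) \<in> parcs D} = (\<lambda>j. 2 * j + 1) ` {..n}"
    unfolding arc_extra[OF assms] by (auto simp: image_iff elim!: oddE)
  then show ?thesis by (simp add: out_degree_eq_card card_image inj_on_def)
qed

text \<open>The most chips a configuration without firings can hold; for \<open>a = n + 1\<close>
  this is \<open>c - 1\<close>.\<close>

lemma sum_out_degree:
  "(\<Sum>v\<in>pverts D. out_degree D v - 1) = (b - Suc n) * n + Suc n * (n - 1)"
proof -
  have "(\<Sum>v=1..2 * Suc n. out_degree D v - 1)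
      = (\<Sum>j<Suc n. (out_degree D (2 * j + 1) - 1) + (out_degree D (2 * j + 2) - 1))"
    by (rule sum_pairs)
  \<comment> \<open>The vertices \<open>2 * j + 1\<close> and \<open>2 * j + 2\<close> both have
    out-degree \<open>j\<close> for \<open>j \<ge> 1\<close>; for \<open>j = 0\<close> the
    out-degrees are \<open>n\<close> and 1.\<close>
  also have "\<dots> = (\<Sum>j<Suc n. if j = 0 then n - 1 else 2 * (j - 1))"
    by (rule sum.cong) (auto simp: out_degree_odd[simplified] out_degree_even[simplified])
  also have "\<dots> = n - 1 + (\<Sum>j<n. 2 * j)"
    by (simp only: sum.lessThan_Suc_shift) simp
  also have "(\<Sum>j<n. 2 * j) = n * (n - 1)"
    by (induction n) (auto simp: algebra_simps)
  also have "n - 1 + n * (n - 1) = Suc n * (n - 1)" by simp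
  finally have "(\<Sum>v=1..2 * Suc n. out_degree D v - 1) = Suc n * (n - 1)" .
  moreover have "(\<Sum>v\<in>{2 * Suc n<..Suc n + b}. out_degree D v - 1) = (b - Suc n) * n"
    using out_degree_extra by simp
  moreover have "{1..2 * Suc n} \<inter> {2 * Suc n<..Suc n + b} = {}" by auto
  ultimately show ?thesis by (simp add: pverts_D sum.union_disjoint)
qed

lemma in_nbrs_extra: "w \<in> {2 * Suc n<..Suc n + b} \<Longrightarrow> {u. (u, w) \<in> parcs D} = {}"
  using useful_Kaa_arcs_range by (fastforce simp: arcs_D)

lemma in_nbrs_first: "{u. (u, 1) \<in> parcs D} = insert (2 * Suc n) {2 * Suc n<..Suc n + b}"
proof (intro set_eqI iffI)
  fix u assume "u \<in> {u. (u, 1) \<in> parcs D}"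
  then have u: "(u, 1) \<in> parcs D" by simp
  then show "u \<in> insert (2 * Suc n) {2 * Suc n<..Suc n + b}"
    by (cases rule: tail_cases) (use u in \<open>auto simp: arc_odd[simplified] arc_even\<close>)
qed (auto simp: arc_even[of "Suc n", simplified] arc_extra)

text \<open>The tail \<open>2 * k\<close> is the cycle predecessor; other even tails come from kind
  (iv), which skips one index and so starts at \<open>k + 2\<close>.\<close>

lemma in_nbrs_odd:
  assumes "1 \<le> k" "k \<le> n"
  shows "{u. (u, 2 * k + 1) \<in> parcs D}
    = insert (2 * k) ((*) 2 ` {k+2..Suc n}) \<union> {2 * Suc n<..Suc n + b}"
proof (intro set_eqI iffI)
  fix u assume "u \<in> {u. (u, 2 * k + 1) \<in> parcs D}"
  then have u: "(u, 2 * k + 1) \<in> parcs D" by simp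
  then show "u \<in> insert (2 * k) ((*) 2 ` {k+2..Suc n}) \<union> {2 * Suc n<..Suc n + b}"
    by (cases rule: tail_cases)
       (use u assms in \<open>auto simp: arc_odd[simplified] arc_even Suc_double_not_eq_double\<close>)
qed (use assms in \<open>auto simp: arc_even arc_extra double_not_eq_Suc_double\<close>)

text \<open>For \<open>k \<ge> 2\<close> the cycle predecessor differs from \<open>v_1\<close>, so
  the listed tails are distinct and each contributes its own summand to the balance.\<close>

lemma in_nbrs_even:
  assumes "2 \<le> k" "k \<le> n"
  shows "{u. (u, 2 * k) \<in> parcs D}
    = insert 1 (insert (2 * (k - 1) + 1) ((\<lambda>j. 2 * j + 1) ` {k+1..n}))"
proof (intro set_eqI iffI)
  fix u assume "u \<in> {u. (u, 2 * k) \<in> parcs D}"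
  then have u: "(u, 2 * k) \<in> parcs D" by simp
  then show "u \<in> insert 1 (insert (2 * (k - 1) + 1) ((\<lambda>j. 2 * j + 1) ` {k+1..n}))"
    by (cases rule: tail_cases)
       (use u assms in \<open>auto simp: arc_odd[simplified] arc_even arc_extra double_not_eq_Suc_double\<close>)
next
  fix u assume "u \<in> insert 1 (insert (2 * (k - 1) + 1) ((\<lambda>j. 2 * j + 1) ` {k+1..n}))"
  then consider "u = 2 * 0 + 1" | "u = 2 * (k - 1) + 1" | j where "u = 2 * j + 1" "k < j" "j \<le> n"
    by auto
  then show "u \<in> {u. (u, 2 * k) \<in> parcs D}"
    using assms arc_odd[of 0 "2 * k"] arc_odd[of "k - 1" "2 * k"] arc_odd[of _ "2 * k"] by cases auto
qed

text \<open>Arcs of kinds (ii) and (iii) stop short of \<open>v_(2a)\<close>, which leaves only the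
  cycle predecessor.\<close>

lemma in_nbrs_last: "{u. (u, 2 * Suc n) \<in> parcs D} = {2 * n + 1}"
proof (intro set_eqI iffI)
  fix u assume "u \<in> {u. (u, 2 * Suc n) \<in> parcs D}"
  then have u: "(u, 2 * Suc n) \<in> parcs D" by simp
  then show "u \<in> {2 * n + 1}"
    by (cases rule: tail_cases)
       (use u n in \<open>auto simp: arc_odd[simplified] arc_even arc_extra double_not_eq_Suc_double\<close>)
next
  fix u assume "u \<in> {2 * n + 1}"
  then have u: "u = 2 * n + 1" by simp
  show "u \<in> {u. (u, 2 * Suc n) \<in> parcs D}"
    unfolding u mem_Collect_eq arc_odd[OF le_refl] by (rule exI[of _ "Suc n"]) simp
qed

section \<open>Lower bound for the period\<close>

lemma period_ge:
  assumes T: "has_period D \<sigma> T"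
    and \<sigma>: "(b - Suc n) * n + Suc n * (n - 1) < (\<Sum>v\<in>pverts D. \<sigma> v)"
  shows "fact (Suc n) \<le> 2 * T"
proof -
  obtain f where fT: "\<And>v. f v \<le> T" and pos: "\<exists>v\<in>pverts D. 0 < f v"
    and bal: "\<And>v. v \<in> pverts D \<Longrightarrow> out_degree D v * f v = (\<Sum>u | (u, v) \<in> parcs D. f u)"
    using firing_vector[OF T] \<sigma> sum_out_degree by metis
  \<comment> \<open>These vertices are sources with positive out-degree, so balance forces zero
    firings.\<close>
  have extra: "f w = 0" if "w \<in> {2 * Suc n<..Suc n + b}" for w
    using bal[of w] in_nbrs_extra[OF that] out_degree_extra[OF that] that by (simp add: pverts_D)
  define x y where "x j = f (2 * j + 1)" and "y k = f (2 * k)" for j k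
  have y_last: "n * x 0 = y (Suc n)"
  proof -
    have "(\<Sum>u | (u, 1) \<in> parcs D. f u) = f (2 * Suc n)"
      unfolding in_nbrs_first using extra by (subst sum.insert) auto
    then show ?thesis using bal[of 1] out_degree_odd[of 0] by (simp add: pverts_D x_def y_def)
  qed
  have x_last: "n * y (Suc n) = x n"
    using bal[of "2 * Suc n"] out_degree_even[of n] n in_nbrs_last
    by (simp add: pverts_D x_def y_def)
  have x_eq: "k * x k = y k + (\<Sum>j=k+2..Suc n. y j)" if k: "1 \<le> k" "k \<le> n" for k
  proof -
    have "(\<Sum>u | (u, 2 * k + 1) \<in> parcs D. f u)
        = (\<Sum>u\<in>insert (2 * k) ((*) 2 ` {k+2..Suc n}). f u)"
      unfolding in_nbrs_odd[OF k] using extra by (intro sum.mono_neutral_right) auto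
    also have "\<dots> = y k + (\<Sum>u\<in>(*) 2 ` {k+2..Suc n}. f u)"
      by (subst sum.insert) (auto simp: y_def)
    also have "(\<Sum>u\<in>(*) 2 ` {k+2..Suc n}. f u) = (\<Sum>j=k+2..Suc n. y j)"
      by (subst sum.reindex) (auto simp: inj_on_def y_def)
    finally show ?thesis
      using bal[of "2 * k + 1"] out_degree_odd[of k] k by (simp add: pverts_D x_def)
  qed
  have y_eq: "(k - 1) * y k = x 0 + x (k - 1) + (\<Sum>j=k+1..n. x j)" if k: "2 \<le> k" "k \<le> n" for k
  proof -
    have "(\<Sum>u | (u, 2 * k) \<in> parcs D. f u)
        = x 0 + (\<Sum>u\<in>insert (2 * (k - 1) + 1) ((\<lambda>j. 2 * j + 1) ` {k+1..n}). f u)"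
      unfolding in_nbrs_even[OF k] using k by (subst sum.insert) (auto simp: x_def)
    also have "\<dots> = x 0 + (x (k - 1) + (\<Sum>u\<in>(\<lambda>j. 2 * j + 1) ` {k+1..n}. f u))"
      using k by (subst sum.insert) (auto simp: x_def)
    also have "(\<Sum>u\<in>(\<lambda>j. 2 * j + 1) ` {k+1..n}. f u) = (\<Sum>j=k+1..n. x j)"
      by (subst sum.reindex) (auto simp: inj_on_def x_def)
    moreover have "2 * (k - 1) + 2 = 2 * k" using k by simp
    ultimately show ?thesis
      using bal[of "2 * k"] out_degree_even[of "k - 1"] k by (simp add: pverts_D y_def)
  qed
  \<comment> \<open>If \<open>v_1\<close> never fired in a period, \<open>balance_zero\<close> would
    annihilate the whole firing vector, contradicting \<open>pos\<close>.\<close>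
  have "0 < x 0"
  proof (rule ccontr)
    assume "\<not> 0 < x 0"
    then have x0: "x 0 = 0" and yl: "y (Suc n) = 0" using y_last by auto
    have zero: "x k = 0 \<and> y k = 0" if "1 \<le> k" "k \<le> n" for k
      using balance_zero[OF x_last x0 yl x_eq y_eq that] .
    have "f v = 0" if "v \<in> pverts D" for v
    proof (cases "v \<in> {1..2 * Suc n}")
      case True
      then show ?thesis
      proof (cases rule: vertex_cases)
        case (odd j)
        then show ?thesis using zero[of j] x0 by (cases "j = 0") (auto simp: x_def)
      next
        case (even k)
        then show ?thesis using zero[of k] yl by (cases "k = Suc n") (auto simp: y_def)
      qed
    qed (use that extra pverts_D in auto)
    then show False using pos by auto
  qed
  then have "fact (Suc n) \<le> fact (Suc n) * x 0" by simp
  also have "\<dots> \<le> 2 * x 2"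
    using balance_growth[OF n y_last x_last x_eq y_eq] .
  also have "\<dots> \<le> 2 * T" using fT by (simp add: x_def)
  finally show ?thesis .
qed

lemma convergent_period_ge:
  "fact (Suc n) \<le> 2 * convergent_period ((b - Suc n) * n + Suc n * (n - 1) + 1) D"
proof -
  have "pverts D \<noteq> {}" by (simp add: pverts_D)
  from convergent_period_attained[OF this] obtain \<sigma> where
    "(b - Suc n) * n + Suc n * (n - 1) + 1 \<le> (\<Sum>v\<in>pverts D. \<sigma> v)"
    "has_period D \<sigma> (convergent_period ((b - Suc n) * n + Suc n * (n - 1) + 1) D)" .
  then show ?thesis by (intro period_ge) auto
qed

end

theorem corollary3p17:
  shows "\<exists>\<kappa>::real. 0 < \<kappa> \<and> (\<exists>N::nat. \<forall>(a::nat) (b::nat) (D::nat pair_pre_digraph).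
           2 \<le> a \<and> N \<le> a \<and> a \<le> b \<and> useful_Kab a b D \<longrightarrow>
           \<kappa> * fact a \<le> real (convergent_period ((b - a) * (a - 1) + a * (a - 2) + 1) D))"
\<comment> \<open>The value 1/2 undoes the factor 2 in \<open>convergent_period_ge\<close>;
  \<open>a \<ge> 3\<close> is the condition \<open>2 \<le> n\<close> for
  \<open>n = a - 1\<close>.\<close>
proof (intro exI[of _ "1/2"] conjI exI[of _ 3] allI impI)
  fix a b :: nat and D :: "nat pair_pre_digraph"
  assume *: "2 \<le> a \<and> 3 \<le> a \<and> a \<le> b \<and> useful_Kab a b D"
  then obtain n where a: "a = Suc n" by (cases a) auto
  have "real (fact a) \<le> real (2 * convergent_period ((b - a) * (a - 1) + a * (a - 2) + 1) D)"
    using convergent_period_ge[of n b D] * unfolding a of_nat_le_iff by simp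
  then show "1/2 * fact a \<le> real (convergent_period ((b - a) * (a - 1) + a * (a - 2) + 1) D)"
    by simp
qed simp

end
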